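(* Let $a,b\geq 0$ and $k\geq a+b+2$ be integers. Then \[ x\bigl(x^{k-a-b-2}\ \text{ш}\ y^b\bigr)y^{a+1}-x^{k-a-b-1}\bigl(x^b\ \text{ш}\ y^a\bigr)y\ \in\ \sum_{n\geq 1}\partial_n(x\,\mathfrak{h}\,y), \] where the right-hand side is the sum (as $\mathbb{Q}$-subspaces of $\mathfrak{h}$) of the images $\partial_n(x\mathfrak{h}y)$, $n\geq 1$.
   Context: Let $\mathfrak{h}=\mathbb{Q}\langle x,y\rangle$ be the noncommutative polynomial algebra over $\mathbb{Q}$ in two indeterminates $x,y$, and let $x\mathfrak{h}y$ denote the $\mathbb{Q}$-span of words beginning with $x$ and ending with $y$. The shuffle product $\text{ш}$ is the $\mathbb{Q}$-bilinear map $\mathfrak{h}\times\mathfrak{h}\to\mathfrak{h}$ defined by $1\ \text{ш}\ w=w\ \text{ш}\ 1=w$ and $uw\ \text{ш}\ vw'=u(w\ \text{ш}\ vw')+v(uw\ \text{ш}\ w')$ for letters $u,v\in\{x,y\}$ and words $w,w'$. Let $z=x+y$. For each $n\geq 1$, $\partial_n$ is the derivation of $\mathfrak{h}$ (a $\mathbb{Q}$-linear map with $\partial_n(ww')=\partial_n(w)w'+w\partial_n(w')$) determined by $\partial_n(x)=xz^{n-1}y$ and $\partial_n(y)=-xz^{n-1}y$. *)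

theory Defs
  imports Complex_Main "HOL-Library.Poly_Mapping"
begin

text \<open>
  Words are lists of letters. Turning lists into the (additively written) free monoid makes
  the convolution product of \<^typ>\<open>'a \<Rightarrow>\<^sub>0 'b\<close> the product of the noncommutative polynomial ring.
\<close>

instantiation list :: (type) monoid_add
begin

definition zero_list :: "'a list" where "zero_list = []"

definition plus_list :: "'a list \<Rightarrow> 'a list \<Rightarrow> 'a list" where "plus_list u v = u @ v"

instance by standard (simp_all add: zero_list_def plus_list_def)

end

datatype letter = Lx | Ly

type_synonym ncpoly = "letter list \<Rightarrow>\<^sub>0 rat"

abbreviation coeff :: "ncpoly \<Rightarrow> letter list \<Rightarrow> rat" where
  "coeff \<equiv> Poly_Mapping.lookup"

abbreviation support :: "ncpoly \<Rightarrow> letter list set" where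
  "support \<equiv> Poly_Mapping.keys"

definition scale :: "rat \<Rightarrow> ncpoly \<Rightarrow> ncpoly" where
  "scale c p = Poly_Mapping.single 0 c * p"

interpretation ncpoly: vector_space scale
  by standard
    (simp_all add: scale_def distrib_left distrib_right single_add mult_single flip: mult.assoc)

definition of_word :: "letter list \<Rightarrow> ncpoly" where
  "of_word w = Poly_Mapping.single w 1"

definition lin_ext :: "(letter list \<Rightarrow> ncpoly) \<Rightarrow> ncpoly \<Rightarrow> ncpoly" where
  "lin_ext f p = (\<Sum>w\<in>support p. scale (coeff p w) (f w))"

definition X :: ncpoly where "X = of_word [Lx]"

definition Y :: ncpoly where "Y = of_word [Ly]"

definition Z :: ncpoly where "Z = X + Y"

definition xhy :: "ncpoly set" where
  "xhy = ncpoly.span {of_word (Lx # w @ [Ly]) | w. True}"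

fun shuffle_word :: "letter list \<Rightarrow> letter list \<Rightarrow> ncpoly" where
  "shuffle_word [] w = of_word w"
| "shuffle_word w [] = of_word w"
| "shuffle_word (u # w) (v # w') =
     of_word [u] * shuffle_word w (v # w') + of_word [v] * shuffle_word (u # w) w'"

definition shuffle :: "ncpoly \<Rightarrow> ncpoly \<Rightarrow> ncpoly"  (infixl \<open>\<squnion>\<close> 70) where
  "p \<squnion> q = lin_ext (\<lambda>u. lin_ext (shuffle_word u) q) p"

definition derivation :: "(ncpoly \<Rightarrow> ncpoly) \<Rightarrow> bool" where
  "derivation d \<longleftrightarrow>
     Vector_Spaces.linear scale scale d \<and> (\<forall>p q. d (p * q) = d p * q + p * d q)"

text \<open>
  The derivation \<open>\<partial> n\<close> is constructed by the Leibniz rule on words and linear extension;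
  \<open>partial_deriv_unique\<close> below shows that it is the derivation determined by its values on
  \<^const>\<open>X\<close> and \<^const>\<open>Y\<close>.
\<close>

fun partial_letter :: "nat \<Rightarrow> letter \<Rightarrow> ncpoly" where
  "partial_letter n Lx = X * Z ^ (n - 1) * Y"
| "partial_letter n Ly = - (X * Z ^ (n - 1) * Y)"

fun partial_word :: "nat \<Rightarrow> letter list \<Rightarrow> ncpoly" where
  "partial_word n [] = 0"
| "partial_word n (u # w) = partial_letter n u * of_word w + of_word [u] * partial_word n w"

definition partial_deriv :: "nat \<Rightarrow> ncpoly \<Rightarrow> ncpoly"  (\<open>\<partial>\<close>) where
  "\<partial> n = lin_ext (partial_word n)"

definition subspace_sum :: "'i set \<Rightarrow> ('i \<Rightarrow> 'a::comm_monoid_add set) \<Rightarrow> 'a set" where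
  "subspace_sum I V = {\<Sum>i\<in>F. f i | F f. finite F \<and> F \<subseteq> I \<and> (\<forall>i\<in>F. f i \<in> V i)}"

lemma of_word_Nil: "of_word [] = 1"
  by (simp add: of_word_def flip: zero_list_def)

lemma of_word_append: "of_word (u @ v) = of_word u * of_word v"
  by (simp add: of_word_def mult_single plus_list_def)

lemma of_word_Cons: "of_word (a # w) = of_word [a] * of_word w"
  using of_word_append[of "[a]" w] by simp

lemma scale_of_word: "scale c (of_word w) = Poly_Mapping.single w c"
  by (simp add: scale_def of_word_def mult_single)

lemma coeff_scale: "coeff (scale c p) w = c * coeff p w"
proof -
  have "scale c p = Poly_Mapping.map ((*) c) p"
    by (simp add: scale_def mult_map_scale_conv_mult)
  then show ?thesis by (simp add: Poly_Mapping.map.rep_eq when_def)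
qed

lemma ncpoly_expand: "p = (\<Sum>w\<in>support p. scale (coeff p w) (of_word w))"
proof (rule poly_mapping_eqI)
  fix k
  have "coeff (\<Sum>w\<in>support p. scale (coeff p w) (of_word w)) k =
      (\<Sum>w\<in>support p. if w = k then coeff p w else 0)"
    unfolding lookup_sum by (rule sum.cong) (auto simp: scale_of_word lookup_single when_def)
  then show "coeff p k = coeff (\<Sum>w\<in>support p. scale (coeff p w) (of_word w)) k"
    by (auto simp: in_keys_iff)
qed

lemma scale_mult_left: "scale c p * q = scale c (p * q)"
  by (simp add: scale_def mult.assoc)

lemma scale_mult_right: "p * scale c q = scale c (p * q)"
proof -
  have "Poly_Mapping.single w r * Poly_Mapping.single 0 c =
      Poly_Mapping.single 0 c * Poly_Mapping.single w r" for w :: "letter list" and r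
    by (simp add: mult_single mult.commute)
  then have "(\<Sum>w\<in>support p. scale (coeff p w) (of_word w)) * Poly_Mapping.single 0 c =
      Poly_Mapping.single 0 c * (\<Sum>w\<in>support p. scale (coeff p w) (of_word w))"
    unfolding scale_of_word sum_distrib_left sum_distrib_right by simp
  then have "p * Poly_Mapping.single 0 c = Poly_Mapping.single 0 c * p"
    unfolding ncpoly_expand[symmetric] .
  then show ?thesis
    unfolding scale_def mult.assoc[symmetric] by simp
qed

lemma lin_ext_superset:
  assumes "finite S" "support p \<subseteq> S"
  shows "lin_ext f p = (\<Sum>w\<in>S. scale (coeff p w) (f w))"
  unfolding lin_ext_def using assms
  by (intro sum.mono_neutral_left) (auto simp: in_keys_iff)

lemma linear_lin_ext: "Vector_Spaces.linear scale scale (lin_ext f)"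
proof (rule Vector_Spaces.linear_iff[THEN iffD2], intro conjI allI)
  fix p q :: ncpoly
  let ?S = "support p \<union> support q"
  have "lin_ext f (p + q) = (\<Sum>w\<in>?S. scale (coeff (p + q) w) (f w))"
    by (rule lin_ext_superset) (simp_all add: keys_add)
  moreover have "lin_ext f p = (\<Sum>w\<in>?S. scale (coeff p w) (f w))"
    by (rule lin_ext_superset) simp_all
  moreover have "lin_ext f q = (\<Sum>w\<in>?S. scale (coeff q w) (f w))"
    by (rule lin_ext_superset) simp_all
  ultimately show "lin_ext f (p + q) = lin_ext f p + lin_ext f q"
    by (simp add: lookup_add ncpoly.scale_left_distrib sum.distrib)
next
  fix c and p :: ncpoly
  have "lin_ext f (scale c p) = (\<Sum>w\<in>support p. scale (coeff (scale c p) w) (f w))"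
    by (rule lin_ext_superset) (auto simp: in_keys_iff coeff_scale)
  then show "lin_ext f (scale c p) = scale c (lin_ext f p)"
    by (simp add: lin_ext_def coeff_scale ncpoly.scale_sum_right)
qed (rule ncpoly.vector_space_axioms)+

lemma lin_ext_of_word: "lin_ext f (of_word w) = f w"
  by (simp add: lin_ext_def of_word_def)

lemma linear_eqI:
  assumes "Vector_Spaces.linear scale scale d" "Vector_Spaces.linear scale scale e"
    and "\<And>w. d (of_word w) = e (of_word w)"
  shows "d p = e p"
proof -
  interpret d: Vector_Spaces.linear scale scale d by fact
  interpret e: Vector_Spaces.linear scale scale e by fact
  have "d (\<Sum>w\<in>support p. scale (coeff p w) (of_word w)) =
      e (\<Sum>w\<in>support p. scale (coeff p w) (of_word w))"
    by (simp add: d.sum d.scale e.sum e.scale assms(3))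
  then show ?thesis unfolding ncpoly_expand[symmetric] .
qed

lemma shuffle_of_word: "of_word u \<squnion> of_word v = shuffle_word u v"
  by (simp add: shuffle_def lin_ext_of_word)

lemma linear_shuffle_left: "Vector_Spaces.linear scale scale (\<lambda>p. p \<squnion> q)"
  unfolding shuffle_def by (rule linear_lin_ext)

lemma linear_shuffle_right: "Vector_Spaces.linear scale scale (\<lambda>q. p \<squnion> q)"
proof -
  interpret L: Vector_Spaces.linear scale scale "lin_ext f" for f
    by (rule linear_lin_ext)
  show ?thesis
    unfolding Vector_Spaces.linear_iff shuffle_def L.add L.scale
    by (simp add: ncpoly.vector_space_axioms lin_ext_def[where p = p]
        ncpoly.scale_right_distrib sum.distrib ncpoly.scale_sum_right
        ncpoly.scale_left_commute del: ncpoly.scale_scale)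
qed

lemma linear_partial_deriv: "Vector_Spaces.linear scale scale (\<partial> n)"
  unfolding partial_deriv_def by (rule linear_lin_ext)

lemma partial_deriv_of_word: "\<partial> n (of_word w) = partial_word n w"
  by (simp add: partial_deriv_def lin_ext_of_word)

lemma partial_word_append:
  "partial_word n (u @ v) = partial_word n u * of_word v + of_word u * partial_word n v"
proof (induction u)
  case Nil
  show ?case by (simp add: of_word_Nil)
next
  case (Cons a u)
  then show ?case
    by (simp add: of_word_append of_word_Cons[of a u] distrib_left distrib_right mult.assoc
        add.assoc)
qed

lemma leibniz_extend:
  assumes "\<And>u v. d (of_word u * of_word v) = d (of_word u) * of_word v + of_word u * d (of_word v)"
    and "Vector_Spaces.linear scale scale d"
  shows "d (p * q) = d p * q + p * d q"
proof -
  interpret d: Vector_Spaces.linear scale scale d by fact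
  have lin: "Vector_Spaces.linear scale scale (\<lambda>p. d (p * q))"
    "Vector_Spaces.linear scale scale (\<lambda>p. d p * q + p * d q)"
    "Vector_Spaces.linear scale scale (\<lambda>p. d (q * p))"
    "Vector_Spaces.linear scale scale (\<lambda>p. d q * p + q * d p)" for q
    by (simp_all add: Vector_Spaces.linear_iff ncpoly.vector_space_axioms d.add d.scale
        algebra_simps scale_mult_left scale_mult_right ncpoly.scale_right_distrib)
  have "d (of_word u * q) = d (of_word u) * q + of_word u * d q" for u q
    by (rule linear_eqI[OF lin(3) lin(4)]) (rule assms(1))
  then show ?thesis
    by (rule linear_eqI[OF lin(1) lin(2)])
qed

lemma derivation_partial_deriv: "derivation (\<partial> n)"
proof -
  have "\<partial> n (of_word u * of_word v) =
      \<partial> n (of_word u) * of_word v + of_word u * \<partial> n (of_word v)" for u v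
    unfolding of_word_append[symmetric] partial_deriv_of_word by (rule partial_word_append)
  then show ?thesis
    using leibniz_extend[OF _ linear_partial_deriv] by (auto simp: derivation_def linear_partial_deriv)
qed

lemma partial_deriv_X: "\<partial> n X = X * Z ^ (n - 1) * Y"
  by (simp add: X_def partial_deriv_of_word of_word_Nil)

lemma partial_deriv_Y: "\<partial> n Y = - (X * Z ^ (n - 1) * Y)"
  by (simp add: Y_def partial_deriv_of_word of_word_Nil)

lemma partial_deriv_unique:
  assumes "derivation d" "d X = X * Z ^ (n - 1) * Y" "d Y = - (X * Z ^ (n - 1) * Y)"
  shows "d = \<partial> n"
proof
  fix p
  have leib: "d (p * q) = d p * q + p * d q" for p q
    using assms(1) by (simp add: derivation_def)
  have "d 1 = 0" using leib[of 1 1] by simp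
  moreover have "d (of_word [u]) = partial_letter n u" for u
    using assms(2,3) by (cases u) (simp_all flip: X_def Y_def)
  ultimately have letter: "d 1 = 0" "d (of_word [u]) = partial_letter n u" for u
    by simp_all
  have "d (of_word w) = partial_word n w" for w
  proof (induction w)
    case Nil
    show ?case by (simp add: of_word_Nil letter)
  next
    case (Cons u w)
    then show ?case unfolding of_word_Cons[of u w] leib by (simp add: letter)
  qed
  then have "d (of_word w) = \<partial> n (of_word w)" for w
    by (simp only: partial_deriv_of_word)
  moreover have "Vector_Spaces.linear scale scale d"
    using assms(1) by (simp add: derivation_def)
  ultimately show "d p = \<partial> n p"
    using linear_eqI linear_partial_deriv by blast
qed

end

theory Submission
  imports Defs "HOL-Computational_Algebra.Formal_Power_Series"
begin

text \<open>
  The automorphism \<open>\<Delta> = exp (\<Sum>n\<ge>1. \<partial> n t^n / n)\<close> of the power series ring in a central variable \<open>t\<close>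
  over the noncommutative polynomials satisfies \<open>\<Delta> x = x (1 - t y)\<^sup>-\<^sup>1\<close> and
  \<open>\<Delta> ((1 - t x)\<^sup>-\<^sup>1 y) = y\<close>. Hence with \<open>p = k - a - b - 2\<close> it maps
  \<open>x^(p+1) ((1 - t x)\<^sup>-\<^sup>1 y)^(a+1)\<close>, the generating series of \<open>x^(p+1) (x^b \<squnion> y^a) y\<close> over \<open>b\<close>, to
  \<open>(x (1 - t y)\<^sup>-\<^sup>1)^(p+1) y^(a+1)\<close>, the generating series of \<open>x (x^p \<squnion> y^b) y^(a+1)\<close>.
  Every coefficient of \<open>\<Delta> - 1\<close> maps \<open>xhy\<close> into the sum of the \<open>\<partial> n xhy\<close>.
\<close>

unbundle fps_syntax

section \<open>The derivations \<open>\<partial> n\<close> on the subspace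
  \<open>xhy\<close>\<close>

interpretation partial: Vector_Spaces.linear scale scale "\<partial> n" for n
  by (rule linear_partial_deriv)

lemma partial_deriv_mult: "\<partial> n (p * q) = \<partial> n p * q + p * \<partial> n q"
  using derivation_partial_deriv by (simp add: derivation_def)

lemma partial_deriv_Z: "\<partial> n Z = 0"
  by (simp add: Z_def partial.add partial_deriv_X partial_deriv_Y)

lemma scale_of_nat: "scale (of_nat n) p = of_nat n * p"
  by (induction n) (simp_all add: ncpoly.scale_left_distrib distrib_right)

text \<open>The factored form lets membership in \<open>xhy\<close> be shown by exhibiting a middle
  factor instead of expanding into words.\<close>

lemma xhy_eq: "xhy = range (\<lambda>q. X * q * Y)"
proof
  have word: "of_word (Lx # w @ [Ly]) = X * of_word w * Y" for w
    by (simp add: X_def Y_def of_word_append[symmetric])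
  have "X * q * Y \<in> xhy" for q
  proof -
    have "X * (\<Sum>w\<in>support q. scale (coeff q w) (of_word w)) * Y =
        (\<Sum>w\<in>support q. scale (coeff q w) (of_word (Lx # w @ [Ly])))"
      by (simp add: word sum_distrib_left sum_distrib_right scale_mult_left scale_mult_right)
    also have "\<dots> \<in> xhy"
      unfolding xhy_def
      by (intro ncpoly.span_sum ncpoly.span_scale ncpoly.span_base) blast
    finally show ?thesis
      unfolding ncpoly_expand[symmetric] .
  qed
  then show "range (\<lambda>q. X * q * Y) \<subseteq> xhy" by blast
  have "ncpoly.subspace (range (\<lambda>q. X * q * Y))"
  proof (rule ncpoly.subspaceI)
    show "0 \<in> range (\<lambda>q. X * q * Y)" by (rule range_eqI[of _ _ 0]) simp
  next
    fix p q assume "p \<in> range (\<lambda>q. X * q * Y)" "q \<in> range (\<lambda>q. X * q * Y)"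
    then obtain p' q' where "p = X * p' * Y" "q = X * q' * Y" by blast
    then have "p + q = X * (p' + q') * Y" by (simp add: algebra_simps)
    then show "p + q \<in> range (\<lambda>q. X * q * Y)" by blast
  next
    fix c p assume "p \<in> range (\<lambda>q. X * q * Y)"
    then obtain p' where "p = X * p' * Y" by blast
    then have "scale c p = X * scale c p' * Y" by (simp add: scale_mult_left scale_mult_right)
    then show "scale c p \<in> range (\<lambda>q. X * q * Y)" by blast
  qed
  then show "xhy \<subseteq> range (\<lambda>q. X * q * Y)"
    unfolding xhy_def by (rule ncpoly.span_minimal[rotated]) (auto simp: word)
qed

lemma subspace_xhy: "ncpoly.subspace xhy"
  unfolding xhy_def by (rule ncpoly.subspace_span)

text \<open>In the product rule on \<open>X * q * Y\<close>, every term still starts with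
  \<open>X\<close> and ends with \<open>Y\<close>, since \<open>\<partial> n X\<close> and
  \<open>\<partial> n Y\<close> are both, up to sign, \<open>X * Z ^ (n - 1) * Y\<close>.\<close>

lemma partial_deriv_xhy:
  assumes "p \<in> xhy"
  shows "\<partial> n p \<in> xhy"
proof -
  from assms obtain q where "p = X * q * Y" by (auto simp: xhy_eq)
  then have "\<partial> n p = X * (Z ^ (n - 1) * Y * q + \<partial> n q - q * X * Z ^ (n - 1)) * Y"
    by (simp add: partial_deriv_mult partial_deriv_X partial_deriv_Y algebra_simps)
  then show ?thesis by (auto simp: xhy_eq)
qed

section \<open>Closure properties of sums of subspaces\<close>

lemma subspace_sum_add:
  assumes zero: "\<And>i. i \<in> I \<Longrightarrow> 0 \<in> V i"
    and add: "\<And>i x y. i \<in> I \<Longrightarrow> x \<in> V i \<Longrightarrow> y \<in> V i \<Longrightarrow> x + y \<in> V i"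
    and p: "p \<in> subspace_sum I V" and q: "q \<in> subspace_sum I V"
  shows "p + q \<in> subspace_sum I V"
proof -
  from p obtain F f where F: "finite F" "F \<subseteq> I" "\<forall>i\<in>F. f i \<in> V i" "p = sum f F"
    by (auto simp: subspace_sum_def)
  from q obtain G g where G: "finite G" "G \<subseteq> I" "\<forall>i\<in>G. g i \<in> V i" "q = sum g G"
    by (auto simp: subspace_sum_def)
  let ?f = "\<lambda>i. if i \<in> F then f i else 0" and ?g = "\<lambda>i. if i \<in> G then g i else 0"
  have "p = sum ?f (F \<union> G)" "q = sum ?g (F \<union> G)"
    unfolding F(4) G(4) using F(1) G(1)
    by (auto intro!: sum.mono_neutral_cong_left)
  then have "p + q = (\<Sum>i\<in>F \<union> G. ?f i + ?g i)" by (simp add: sum.distrib)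
  moreover have "\<forall>i\<in>F \<union> G. ?f i + ?g i \<in> V i"
    using F G by (auto intro!: add zero)
  ultimately show ?thesis
    unfolding subspace_sum_def using F(1,2) G(1,2) by blast
qed

lemma subspace_sum_base:
  assumes "i \<in> I" "p \<in> V i"
  shows "p \<in> subspace_sum I V"
  unfolding subspace_sum_def using assms
  by (intro CollectI exI[of _ "{i}"] exI[of _ "\<lambda>_. p"]) simp

lemma subspace_sum_sum:
  assumes zero: "\<And>i. i \<in> I \<Longrightarrow> 0 \<in> V i"
    and add: "\<And>i x y. i \<in> I \<Longrightarrow> x \<in> V i \<Longrightarrow> y \<in> V i \<Longrightarrow> x + y \<in> V i"
    and "\<And>j. j \<in> A \<Longrightarrow> p j \<in> subspace_sum I V"
  shows "sum p A \<in> subspace_sum I V"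
proof -
  have "0 \<in> subspace_sum I V"
    by (auto simp: subspace_sum_def intro!: exI[of _ "{}"])
  with assms(3) show ?thesis
    by (induction A rule: infinite_finite_induct) (auto intro: subspace_sum_add[OF zero add])
qed

section \<open>Reindexing of sums, and the coefficients of \<Delta> with their product rule\<close>

lemma sum_triangle_swap:
  fixes f :: "nat \<Rightarrow> nat \<Rightarrow> 'a::comm_monoid_add"
  shows "(\<Sum>i\<le>n. \<Sum>j\<le>n - i. f i j) = (\<Sum>j\<le>n. \<Sum>i\<le>n - j. f i j)"
proof -
  have "{..n - i} = {j \<in> {..n}. i + j \<le> n}" "{..n - i} = {j \<in> {..n}. j + i \<le> n}" if "i \<le> n" for i
    using that by auto
  then show ?thesis
    using sum.swap_restrict[of "{..n}" "{..n}" f "\<lambda>i j. i + j \<le> n"] by simp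
qed

lemma sum_atMost_rev: "(\<Sum>i\<le>n. f i) = (\<Sum>i\<le>n. f (n - i))" for n :: nat
  by (rule sum.reindex_bij_witness[of _ "\<lambda>i. n - i" "\<lambda>i. n - i"]) auto

text \<open>
  \<open>exp_deriv n\<close> is the coefficient of \<open>t^n\<close> in \<open>\<Delta>\<close>; the recursion is
  \<open>d\<Delta>/dt = (\<Sum>n\<ge>1. \<partial> n t^(n-1)) \<Delta>\<close>.
\<close>

fun exp_deriv :: "nat \<Rightarrow> ncpoly \<Rightarrow> ncpoly" where
  "exp_deriv 0 p = p"
| "exp_deriv (Suc n) p = scale (1 / of_nat (Suc n)) (\<Sum>i\<le>n. \<partial> (Suc i) (exp_deriv (n - i) p))"

lemma linear_exp_deriv: "Vector_Spaces.linear scale scale (exp_deriv n)"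
proof (induction n rule: less_induct)
  case (less n)
  show ?case
  proof (cases n)
    case 0
    then show ?thesis by (simp add: Vector_Spaces.linear_iff ncpoly.vector_space_axioms)
  next
    case (Suc m)
    have "exp_deriv (m - i) (p + q) = exp_deriv (m - i) p + exp_deriv (m - i) q"
      "exp_deriv (m - i) (scale c p) = scale c (exp_deriv (m - i) p)" for i p q c
      using less[of "m - i"] by (simp_all add: Suc Vector_Spaces.linear_iff)
    then show ?thesis
      by (simp add: Suc Vector_Spaces.linear_iff ncpoly.vector_space_axioms partial.add
          partial.scale sum.distrib ncpoly.scale_right_distrib ncpoly.scale_sum_right mult.commute)
  qed
qed

interpretation exp_deriv: Vector_Spaces.linear scale scale "exp_deriv n" for n
  by (rule linear_exp_deriv)

text \<open>With denominators cleared, coefficient identities become counts of weights;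
  \<open>of_nat_cancel\<close> then divides, as the scalars are rational.\<close>

lemma exp_deriv_Suc:
  "of_nat (Suc n) * exp_deriv (Suc n) p = (\<Sum>i\<le>n. \<partial> (Suc i) (exp_deriv (n - i) p))"
  unfolding scale_of_nat[symmetric] by (simp del: of_nat_Suc)

lemma of_nat_cancel:
  fixes p q :: ncpoly
  assumes "of_nat (Suc n) * p = of_nat (Suc n) * q"
  shows "p = q"
  using assms unfolding scale_of_nat[symmetric] by (simp del: of_nat_Suc)

text \<open>This is multiplicativity of \<Delta>. Under the product rule, the derivatives of the
  left factors contribute weight \<open>j\<close> and those of the right factors weight
  \<open>n - j\<close> to the \<open>j\<close>-th term, which together give the factor
  \<open>n\<close>.\<close>

lemma exp_deriv_mult: "exp_deriv n (p * q) = (\<Sum>i\<le>n. exp_deriv i p * exp_deriv (n - i) q)"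
proof (induction n rule: less_induct)
  case (less n)
  show ?case
  proof (cases n)
    case 0
    then show ?thesis by simp
  next
    case (Suc m)
    let ?D = exp_deriv
    have "of_nat (Suc m) * ?D (Suc m) (p * q) =
        (\<Sum>i\<le>m. \<partial> (Suc i) (\<Sum>j\<le>m - i. ?D j p * ?D (m - i - j) q))"
      unfolding exp_deriv_Suc by (intro sum.cong) (simp_all add: less Suc)
    also have "\<dots> = (\<Sum>i\<le>m. \<Sum>j\<le>m - i. \<partial> (Suc i) (?D j p) * ?D (m - i - j) q) +
        (\<Sum>i\<le>m. \<Sum>j\<le>m - i. ?D j p * \<partial> (Suc i) (?D (m - i - j) q))"
      by (simp add: partial.sum partial_deriv_mult sum.distrib)
    also have "(\<Sum>i\<le>m. \<Sum>j\<le>m - i. ?D j p * \<partial> (Suc i) (?D (m - i - j) q)) =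
        (\<Sum>j\<le>m. ?D j p * (\<Sum>i\<le>m - j. \<partial> (Suc i) (?D (m - j - i) q)))"
      by (subst sum_triangle_swap) (simp add: sum_distrib_left add.commute)
    also have "\<dots> = (\<Sum>j\<le>m. of_nat (Suc m - j) * (?D j p * ?D (Suc m - j) q))"
    proof (intro sum.cong refl)
      fix j assume "j \<in> {..m}"
      then have *: "Suc m - j = Suc (m - j)" by auto
      show "?D j p * (\<Sum>i\<le>m - j. \<partial> (Suc i) (?D (m - j - i) q)) =
          of_nat (Suc m - j) * (?D j p * ?D (Suc m - j) q)"
        unfolding * exp_deriv_Suc[symmetric] scale_of_nat[symmetric] scale_mult_right ..
    qed
    \<comment> \<open>The added term has weight zero.\<close>
    also have "\<dots> = (\<Sum>j\<le>Suc m. of_nat (Suc m - j) * (?D j p * ?D (Suc m - j) q))"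
      by simp
    \<comment> \<open>Reversing \<open>j\<close> makes the index of the \<open>q\<close> factor
      independent of \<open>i\<close>, so that swapping the sums collects the recursion for
      \<open>p\<close>.\<close>
    also have "(\<Sum>i\<le>m. \<Sum>j\<le>m - i. \<partial> (Suc i) (?D j p) * ?D (m - i - j) q) =
        (\<Sum>i\<le>m. \<Sum>j\<le>m - i. \<partial> (Suc i) (?D (m - i - j) p) * ?D j q)"
    proof (rule sum.cong[OF refl])
      fix i
      show "(\<Sum>j\<le>m - i. \<partial> (Suc i) (?D j p) * ?D (m - i - j) q) =
          (\<Sum>j\<le>m - i. \<partial> (Suc i) (?D (m - i - j) p) * ?D j q)"
        by (subst sum_atMost_rev) (intro sum.cong refl, simp only: atMost_iff diff_diff_cancel)
    qed
    also have "\<dots> = (\<Sum>j\<le>m. (\<Sum>i\<le>m - j. \<partial> (Suc i) (?D (m - j - i) p)) * ?D j q)"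
      by (subst sum_triangle_swap) (simp add: sum_distrib_right add.commute)
    also have "\<dots> = (\<Sum>j\<le>m. of_nat (Suc m - j) * (?D (Suc m - j) p * ?D j q))"
    proof (intro sum.cong refl)
      fix j assume "j \<in> {..m}"
      then have *: "Suc m - j = Suc (m - j)" by auto
      show "(\<Sum>i\<le>m - j. \<partial> (Suc i) (?D (m - j - i) p)) * ?D j q =
          of_nat (Suc m - j) * (?D (Suc m - j) p * ?D j q)"
        unfolding * exp_deriv_Suc[symmetric] mult.assoc ..
    qed
    also have "\<dots> = (\<Sum>j\<le>Suc m. of_nat (Suc m - j) * (?D (Suc m - j) p * ?D j q))"
      by simp
    also have "\<dots> = (\<Sum>j\<le>Suc m. of_nat j * (?D j p * ?D (Suc m - j) q))"
      by (subst sum_atMost_rev) (auto intro!: sum.cong)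
    also have "\<dots> + (\<Sum>j\<le>Suc m. of_nat (Suc m - j) * (?D j p * ?D (Suc m - j) q)) =
        (\<Sum>j\<le>Suc m. of_nat (Suc m) * (?D j p * ?D (Suc m - j) q))"
      unfolding sum.distrib[symmetric] distrib_right[symmetric] of_nat_add[symmetric]
      by (intro sum.cong) simp_all
    finally have "of_nat (Suc m) * ?D (Suc m) (p * q) =
        of_nat (Suc m) * (\<Sum>j\<le>Suc m. ?D j p * ?D (Suc m - j) q)"
      by (simp only: sum_distrib_left)
    then show ?thesis
      unfolding Suc by (rule of_nat_cancel)
  qed
qed

section \<open>Values of the coefficients of \<Delta> on the generators\<close>

lemma power_diff_telescope:
  fixes u v :: "'a::ring_1"
  shows "u ^ n = v ^ n + (\<Sum>i<n. v ^ (n - Suc i) * (u - v) * u ^ i)"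
proof (induction n)
  case (Suc n)
  have "(\<Sum>i<n. v ^ (n - i) * (u - v) * u ^ i) = v * (\<Sum>i<n. v ^ (n - Suc i) * (u - v) * u ^ i)"
    unfolding sum_distrib_left
    by (intro sum.cong refl) (simp add: mult.assoc[symmetric] power_Suc[symmetric] Suc_diff_Suc del: power_Suc)
  also have "\<dots> = v * (u ^ n - v ^ n)" using Suc by (simp add: algebra_simps)
  finally show ?case by (simp add: algebra_simps)
qed simp

text \<open>This says that \<open>X * Y ^ n\<close> satisfies the recursion of
  \<open>exp_deriv\<close>. In the induction a right factor \<open>Y\<close> is split off; the terms
  from \<open>\<partial> (Suc i) Y\<close> telescope, because \<open>X = Z - Y\<close>, and turn the
  last term \<open>X * Z ^ n * Y\<close> into \<open>X * Y ^ n * Y\<close>.\<close>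

lemma sum_partial_deriv_X_power_Y:
  "(\<Sum>i<n. \<partial> (Suc i) (X * Y ^ (n - Suc i))) = of_nat n * (X * Y ^ n)"
proof (induction n)
  case (Suc n)
  have "(\<Sum>i<Suc n. \<partial> (Suc i) (X * Y ^ (Suc n - Suc i))) =
      (\<Sum>i<n. \<partial> (Suc i) (X * Y ^ (n - Suc i) * Y)) + X * Z ^ n * Y"
    by (auto simp: partial_deriv_X mult.assoc power_Suc2[symmetric] Suc_diff_Suc
        simp del: power_Suc power_Suc2 intro!: sum.cong)
  also have "\<dots> = (\<Sum>i<n. \<partial> (Suc i) (X * Y ^ (n - Suc i))) * Y
      + X * (Z ^ n - (\<Sum>i<n. Y ^ (n - Suc i) * X * Z ^ i)) * Y"
    unfolding partial_deriv_mult[of _ _ Y] partial_deriv_Y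
    by (simp add: sum.distrib sum_distrib_right sum_distrib_left sum_negf sum_subtractf algebra_simps)
  also have "Z ^ n - (\<Sum>i<n. Y ^ (n - Suc i) * X * Z ^ i) = Y ^ n"
    using power_diff_telescope[of Z n Y] by (simp add: Z_def)
  finally show ?case
    unfolding Suc by (simp add: algebra_simps power_commutes)
qed simp

lemma exp_deriv_X: "exp_deriv n X = X * Y ^ n"
proof (induction n rule: less_induct)
  case (less n)
  show ?case
  proof (cases n)
    case (Suc m)
    have "of_nat (Suc m) * exp_deriv (Suc m) X = of_nat (Suc m) * (X * Y ^ Suc m)"
      unfolding exp_deriv_Suc sum_partial_deriv_X_power_Y[symmetric] lessThan_Suc_atMost
      by (intro sum.cong) (simp_all add: less Suc)
    then show ?thesis unfolding Suc by (rule of_nat_cancel)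
  qed simp
qed

text \<open>Every \<open>\<partial> n\<close> kills \<open>Z\<close>, so \<Delta> fixes it; the
  values on \<open>Y\<close> then follow from those on \<open>X\<close>.\<close>

lemma exp_deriv_Z: "exp_deriv n Z = (if n = 0 then Z else 0)"
proof (induction n rule: less_induct)
  case (less n)
  show ?case
  proof (cases n)
    case (Suc m)
    have "\<partial> (Suc i) (exp_deriv (m - i) Z) = 0" for i
      using less[of "m - i"] by (simp add: Suc partial_deriv_Z)
    then show ?thesis by (simp add: Suc)
  qed simp
qed

lemma exp_deriv_Y: "exp_deriv n Y = (if n = 0 then Y else - (X * Y ^ n))"
proof -
  have "exp_deriv n Y = exp_deriv n Z - exp_deriv n X"
    unfolding Z_def exp_deriv.add by simp
  then show ?thesis unfolding exp_deriv_Z exp_deriv_X by (simp add: Z_def)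
qed

lemma exp_deriv_xhy:
  assumes "p \<in> xhy"
  shows "exp_deriv n p \<in> xhy"
proof (induction n rule: less_induct)
  case (less n)
  show ?case
    by (cases n) (auto simp: assms less simp del: of_nat_Suc
        intro!: ncpoly.subspace_scale ncpoly.subspace_sum subspace_xhy partial_deriv_xhy)
qed

section \<open>Shuffles of powers of letters\<close>

lemma of_word_replicate: "of_word (replicate n u) = of_word [u] ^ n"
  by (induction n) (simp_all add: of_word_Nil of_word_Cons[of u "replicate _ _"])

lemma power_shuffle:
  "of_word [u] ^ m \<squnion> of_word [v] ^ n = shuffle_word (replicate m u) (replicate n v)"
  by (simp add: of_word_replicate[symmetric] shuffle_of_word)

lemma shuffle_power_0: "of_word [u] ^ m \<squnion> 1 = of_word [u] ^ m" "1 \<squnion> of_word [u] ^ m = of_word [u] ^ m"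
  using power_shuffle[of u m u 0] power_shuffle[of u 0 u m]
  by (cases m; simp add: of_word_replicate of_word_Nil of_word_Cons[of u "replicate _ _"])+

lemma shuffle_power_Suc:
  "of_word [u] ^ Suc m \<squnion> of_word [v] ^ Suc n =
    of_word [u] * (of_word [u] ^ m \<squnion> of_word [v] ^ Suc n)
    + of_word [v] * (of_word [u] ^ Suc m \<squnion> of_word [v] ^ n)"
  by (simp only: power_shuffle replicate_Suc shuffle_word.simps)

text \<open>The words are sorted by the number \<open>i\<close> of letters \<open>Y\<close> before
  the first \<open>X\<close>.\<close>

lemma shuffle_X_Y_Suc:
  "X ^ Suc p \<squnion> Y ^ n = (\<Sum>i\<le>n. Y ^ i * X * (X ^ p \<squnion> Y ^ (n - i)))"
proof (induction n)
  case 0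
  show ?case by (simp add: X_def shuffle_power_0 flip: power_Suc)
next
  case (Suc n)
  then show ?case
    using shuffle_power_Suc[of Lx p Ly n]
    unfolding sum.atMost_Suc_shift X_def[symmetric] Y_def[symmetric]
    by (simp add: sum_distrib_left mult.assoc)
qed

text \<open>Splitting off one \<open>X\<close>, the product rule convolves \<open>X * Y ^ i\<close>
  with the induction hypothesis, which is exactly the expansion in
  \<open>shuffle_X_Y_Suc\<close>.\<close>

lemma exp_deriv_X_power: "exp_deriv n (X ^ Suc p) = X * (X ^ p \<squnion> Y ^ n)"
proof (induction p arbitrary: n)
  case 0
  show ?case by (simp add: exp_deriv_X Y_def shuffle_power_0)
next
  case (Suc p)
  then show ?case
    unfolding power_Suc[of X "Suc p"] exp_deriv_mult shuffle_X_Y_Suc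
    by (simp add: exp_deriv_X sum_distrib_left mult.assoc)
qed

section \<open>Power series over the noncommutative polynomials\<close>

text \<open>The \<open>t\<close>-linear extension of \<open>\<Delta>\<close>.\<close>

definition exp_fps :: "ncpoly fps \<Rightarrow> ncpoly fps" where
  "exp_fps F = Abs_fps (\<lambda>n. \<Sum>i\<le>n. exp_deriv i (F $ (n - i)))"

lemma exp_fps_const: "exp_fps (fps_const c) = Abs_fps (\<lambda>n. exp_deriv n c)"
proof (rule fps_ext)
  fix n
  have "exp_deriv i (fps_const c $ (n - i)) = (if i = n then exp_deriv n c else 0)" if "i \<le> n" for i
    using that by auto
  then show "exp_fps (fps_const c) $ n = Abs_fps (\<lambda>n. exp_deriv n c) $ n"
    by (simp add: exp_fps_def)
qed

text \<open>Together with the rules for sums and for \<open>fps_X\<close>, a constant left factor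
  covers the recursions of \<open>shuffle_fps\<close>.\<close>

lemma exp_fps_const_mult: "exp_fps (fps_const c * F) = exp_fps (fps_const c) * exp_fps F"
proof (rule fps_ext)
  fix n
  have "exp_fps (fps_const c * F) $ n =
      (\<Sum>i\<le>n. \<Sum>j\<le>i. exp_deriv j c * exp_deriv (i - j) (F $ (n - i)))"
    by (simp add: exp_fps_def exp_deriv_mult)
  also have "\<dots> = (\<Sum>i\<le>n. \<Sum>j\<le>n - i. exp_deriv j c * exp_deriv (n - i - j) (F $ i))"
    by (subst sum_atMost_rev) (auto intro!: sum.cong)
  also have "\<dots> = (\<Sum>j\<le>n. \<Sum>i\<le>n - j. exp_deriv j c * exp_deriv (n - i - j) (F $ i))"
    by (rule sum_triangle_swap)
  also have "\<dots> = (\<Sum>j\<le>n. exp_deriv j c * (\<Sum>i\<le>n - j. exp_deriv i (F $ (n - j - i))))"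
  proof (intro sum.cong refl)
    fix j
    have index: "n - (n - j - i) - j = i" if "i \<le> n - j" for i
      using that by arith
    show "(\<Sum>i\<le>n - j. exp_deriv j c * exp_deriv (n - i - j) (F $ i)) =
        exp_deriv j c * (\<Sum>i\<le>n - j. exp_deriv i (F $ (n - j - i)))"
      unfolding sum_distrib_left using index
      by (subst sum_atMost_rev) (intro sum.cong refl, simp only: atMost_iff)
  qed
  also have "\<dots> = (exp_fps (fps_const c) * exp_fps F) $ n"
    by (simp add: exp_fps_const fps_mult_nth atLeast0AtMost) (simp add: exp_fps_def)
  finally show "exp_fps (fps_const c * F) $ n = (exp_fps (fps_const c) * exp_fps F) $ n" .
qed

lemma exp_fps_add: "exp_fps (F + G) = exp_fps F + exp_fps G"
  by (rule fps_ext) (simp add: exp_fps_def exp_deriv.add sum.distrib)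

lemma exp_fps_X_mult: "exp_fps (fps_X * F) = fps_X * exp_fps F"
proof (rule fps_ext)
  fix n
  show "exp_fps (fps_X * F) $ n = (fps_X * exp_fps F) $ n"
  proof (cases n)
    case (Suc m)
    then show ?thesis by (auto simp: exp_fps_def Suc_diff_le intro!: sum.cong)
  qed (simp add: exp_fps_def)
qed

text \<open>The factor \<open>fps_X\<close> makes each coefficient depend on lower ones only. This
  replaces inverting \<open>1 - fps_X * K\<close>.\<close>

lemma fps_X_mult_fixpoint_unique:
  fixes F G :: "'a::ring_1 fps"
  assumes "F = C + fps_X * (K * F)" "G = C + fps_X * (K * G)"
  shows "F = G"
proof -
  have "F $ n = G $ n" for n
  proof (induction n rule: less_induct)
    case (less n)
    show ?case
    proof (cases n)
      case 0
      then show ?thesis by (subst assms(1), subst assms(2)) simp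
    next
      case (Suc m)
      have "(K * F) $ m = (K * G) $ m"
        unfolding fps_mult_nth by (intro sum.cong) (simp_all add: less Suc)
      then show ?thesis by (subst assms(1), subst assms(2)) (simp add: Suc)
    qed
  qed
  then show ?thesis by (rule fps_ext)
qed

section \<open>Generating series of the shuffles and their images under \<Delta>\<close>

text \<open>In closed form this is \<open>((1 - t X)\<^sup>-\<^sup>1 Y)^(a+1)\<close>; the two
  recursions below express this without inverses.\<close>

definition shuffle_fps :: "nat \<Rightarrow> ncpoly fps" where
  "shuffle_fps a = Abs_fps (\<lambda>n. (X ^ n \<squnion> Y ^ a) * Y)"

lemma shuffle_fps_0: "shuffle_fps 0 = fps_const Y + fps_X * (fps_const X * shuffle_fps 0)"
proof (rule fps_ext)
  fix n
  show "shuffle_fps 0 $ n = (fps_const Y + fps_X * (fps_const X * shuffle_fps 0)) $ n"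
    by (cases n) (simp_all add: shuffle_fps_def X_def shuffle_power_0 shuffle_power_0[of _ 0, simplified] mult.assoc)
qed

lemma shuffle_fps_Suc:
  "shuffle_fps (Suc a) = fps_const Y * shuffle_fps a + fps_X * (fps_const X * shuffle_fps (Suc a))"
proof (rule fps_ext)
  fix n
  show "shuffle_fps (Suc a) $ n =
      (fps_const Y * shuffle_fps a + fps_X * (fps_const X * shuffle_fps (Suc a))) $ n"
  proof (cases n)
    case 0
    then show ?thesis
      using shuffle_power_0(2)[of Ly a] shuffle_power_0(2)[of Ly "Suc a"]
      by (simp add: shuffle_fps_def Y_def mult.assoc)
  next
    case (Suc m)
    then show ?thesis
      using shuffle_power_Suc[of Lx m Ly a]
      by (simp add: shuffle_fps_def X_def[symmetric] Y_def[symmetric] algebra_simps)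
  qed
qed

text \<open>\<open>\<Delta> y = (1 - t \<Delta> x) y\<close>, with the minus sign moved across.\<close>

lemma exp_fps_Y:
  "fps_const Y = exp_fps (fps_const Y) + fps_X * (exp_fps (fps_const X) * fps_const Y)"
proof (rule fps_ext)
  fix n
  show "fps_const Y $ n =
      (exp_fps (fps_const Y) + fps_X * (exp_fps (fps_const X) * fps_const Y)) $ n"
    by (cases n) (simp_all add: exp_fps_const exp_deriv_Y exp_deriv_X mult.assoc power_commutes)
qed

text \<open>Applying \<Delta> to the recursion of \<open>shuffle_fps\<close> gives a fixpoint
  equation that the constant series also solves, by \<open>exp_fps_Y\<close> multiplied on the right
  by a power of \<open>Y\<close>.\<close>

lemma exp_fps_shuffle_fps: "exp_fps (shuffle_fps a) = fps_const (Y ^ Suc a)"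
proof (induction a)
  case 0
  have "exp_fps (shuffle_fps 0) = exp_fps (fps_const Y)
      + fps_X * (exp_fps (fps_const X) * exp_fps (shuffle_fps 0))"
    by (subst shuffle_fps_0) (simp add: exp_fps_add exp_fps_X_mult exp_fps_const_mult)
  from fps_X_mult_fixpoint_unique[OF this exp_fps_Y] show ?case by simp
next
  case (Suc a)
  have 1: "exp_fps (shuffle_fps (Suc a)) = exp_fps (fps_const Y) * fps_const (Y ^ Suc a)
      + fps_X * (exp_fps (fps_const X) * exp_fps (shuffle_fps (Suc a)))"
    by (subst shuffle_fps_Suc)
      (simp only: exp_fps_add exp_fps_X_mult exp_fps_const_mult Suc.IH)
  have 2: "fps_const Y * fps_const (Y ^ Suc a) = exp_fps (fps_const Y) * fps_const (Y ^ Suc a)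
      + fps_X * (exp_fps (fps_const X) * (fps_const Y * fps_const (Y ^ Suc a)))"
    by (subst exp_fps_Y) (simp only: distrib_right mult.assoc)
  from fps_X_mult_fixpoint_unique[OF 1 2] show ?case by simp
qed


theorem mainTheorem1:
  fixes a b k :: nat
  assumes "k \<ge> a + b + 2"
  shows "X * (X ^ (k - a - b - 2) \<squnion> Y ^ b) * Y ^ (a + 1)
           - X ^ (k - a - b - 1) * (X ^ b \<squnion> Y ^ a) * Y
         \<in> subspace_sum {n. n \<ge> 1} (\<lambda>n. \<partial> n ` xhy)"
proof -
  let ?S = "subspace_sum {n. n \<ge> 1} (\<lambda>n. \<partial> n ` xhy)"
  have zero: "0 \<in> \<partial> n ` xhy" for n
    by (metis image_eqI ncpoly.subspace_0 partial.zero subspace_xhy)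
  have add: "p + q \<in> \<partial> n ` xhy" if "p \<in> \<partial> n ` xhy" "q \<in> \<partial> n ` xhy" for n p q
    using that by (auto simp: partial.add[symmetric] intro!: imageI ncpoly.subspace_add[OF subspace_xhy])
  have exp_deriv_Suc_in: "exp_deriv (Suc n) p \<in> ?S" if "p \<in> xhy" for n p
  proof -
    \<comment> \<open>The scalar moves inside, so that each summand is visibly the image of an
      element of \<open>xhy\<close>.\<close>
    have "exp_deriv (Suc n) p =
        (\<Sum>i\<le>n. \<partial> (Suc i) (scale (1 / of_nat (Suc n)) (exp_deriv (n - i) p)))"
      by (simp add: partial.scale ncpoly.scale_sum_right)
    also have "\<dots> \<in> ?S"
    proof (intro subspace_sum_sum zero add)
      fix i
      show "\<partial> (Suc i) (scale (1 / of_nat (Suc n)) (exp_deriv (n - i) p)) \<in> ?S"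
        by (rule subspace_sum_base[of "Suc i"])
          (auto intro!: imageI ncpoly.subspace_scale subspace_xhy exp_deriv_xhy that)
    qed
    finally show ?thesis .
  qed
  define p where "p = k - a - b - 2"
  have p: "k - a - b - 1 = Suc p" using assms by (simp add: p_def)
  let ?F = "fps_const (X ^ Suc p) * shuffle_fps a"
  have F: "?F $ n = X ^ Suc p * (X ^ n \<squnion> Y ^ a) * Y" for n
    by (simp add: shuffle_fps_def mult.assoc)
  have F_xhy: "?F $ n \<in> xhy" for n
    unfolding F xhy_eq by (rule range_eqI[of _ _ "X ^ p * (X ^ n \<squnion> Y ^ a)"]) (simp add: mult.assoc)
  \<comment> \<open>The coefficient of \<open>t^b\<close> is computed twice: by multiplicativity of
    \<Delta>, and by definition, where the term of index 0 is \<open>?F $ b\<close> itself because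
    \<Delta> has constant term the identity.\<close>
  have "exp_fps ?F $ b = X * (X ^ p \<squnion> Y ^ b) * Y ^ (a + 1)"
    by (simp add: exp_fps_const_mult exp_fps_shuffle_fps exp_fps_const exp_deriv_X_power del: power_Suc)
  moreover have "exp_fps ?F $ b = ?F $ b + (\<Sum>i<b. exp_deriv (Suc i) (?F $ (b - Suc i)))"
    unfolding exp_fps_def by (simp add: sum.atMost_shift del: exp_deriv.simps(2))
  ultimately have "X * (X ^ p \<squnion> Y ^ b) * Y ^ (a + 1) - X ^ Suc p * (X ^ b \<squnion> Y ^ a) * Y =
      (\<Sum>i<b. exp_deriv (Suc i) (?F $ (b - Suc i)))"
    by (simp only: F) (simp add: algebra_simps)
  also have "\<dots> \<in> ?S"
    by (intro subspace_sum_sum zero add exp_deriv_Suc_in F_xhy)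
  finally show ?thesis
    unfolding p p_def .
qed

end
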